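(* Let $-\infty\le a<b\le\infty$, and let $f,g\colon(a,b)\to\mathbb{R}$ be differentiable functions such that $g(x)\neq 0$ and $g'(x)\neq 0$ for every $x\in(a,b)$. Put $$r:=\frac{f}{g},\qquad \rho:=\frac{f'}{g'},\qquad \tilde\rho:=r'\,\frac{g^2}{|g'|}$$ on $(a,b)$, and assume that $\rho$ is monotonic (non-decreasing or non-increasing, not necessarily strictly) on $(a,b)$. If an interval $I\subseteq(a,b)$ is a maximal interval of constancy of $r$, then $I$ is also a maximal interval of constancy of $\rho$ and a maximal interval of constancy of $\tilde\rho$.
   Context: An interval $I\subseteq(a,b)$ is called an interval of constancy of a function $h\colon(a,b)\to\mathbb{R}$ if $I$ has nonzero length and $h$ is constant on $I$. An interval of constancy of $h$ is called maximal if it is not contained in any other interval of constancy of $h$. *)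

theory Defs
  imports "HOL-Analysis.Analysis"
begin

definition interval_of_constancy ::
  "ereal \<Rightarrow> ereal \<Rightarrow> (real \<Rightarrow> real) \<Rightarrow> real set \<Rightarrow> bool" where
  "interval_of_constancy a b h I \<longleftrightarrow>
     is_interval I \<and> I \<subseteq> einterval a b \<and> (\<exists>x\<in>I. \<exists>y\<in>I. x < y) \<and> h constant_on I"

definition maximal_interval_of_constancy ::
  "ereal \<Rightarrow> ereal \<Rightarrow> (real \<Rightarrow> real) \<Rightarrow> real set \<Rightarrow> bool" where
  "maximal_interval_of_constancy a b h I \<longleftrightarrow>
     interval_of_constancy a b h I \<and>
     \<not> (\<exists>J. interval_of_constancy a b h J \<and> J \<noteq> I \<and> I \<subseteq> J)"

end

theory Submission
  imports Defs
begin

text \<open>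
  On a nondegenerate interval, endpoints included, a differentiable function is constant exactly
  when its derivative vanishes there (\<open>constant_on_iff_derivative_zero\<close>). Both claims translate
  the constancy of \<open>r\<close> into the vanishing of a derivative.

  For \<open>\<rho>t\<close>: the factor \<open>g\<^sup>2 / \<bar>g'\<bar>\<close> never vanishes, so \<open>\<rho>t\<close> has the same zeros as
  \<open>r'\<close>. For \<open>\<rho>\<close>: with a real number \<open>c\<close>, the condition \<open>r = c\<close> means \<open>f - c g = 0\<close>, while
  \<open>\<rho> = c\<close> means \<open>(f - c g)' = 0\<close>. So if \<open>r = c\<close> on \<open>I\<close>, then \<open>\<rho> = c\<close> and
  \<open>\<rho>t = 0\<close> on \<open>I\<close>.

  Maximality is inherited because both arguments can be reversed on any interval \<open>J\<close> containing
  \<open>I\<close>: a constant value of \<open>\<rho>\<close> or \<open>\<rho>t\<close> on \<open>J\<close> must be the value on \<open>I\<close>, that is, \<open>c\<close>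
  or \<open>0\<close>. Then \<open>f - c g\<close> or \<open>r\<close> is constant on \<open>J\<close>, and in the first case the constant is
  \<open>0\<close>, its value on \<open>I\<close>. In both cases \<open>r\<close> is constant on \<open>J\<close>, and the maximality of \<open>I\<close>
  for \<open>r\<close> gives \<open>J = I\<close>.
\<close>

text \<open>
  An endpoint that belongs to \<open>I\<close> needs no separate treatment: every point of a nondegenerate
  interval is a limit point of it, so the derivative at that point is determined by the values
  on \<open>I\<close>.
\<close>

lemma constant_on_iff_derivative_zero:
  fixes h h' :: "real \<Rightarrow> real"
  assumes I: "is_interval I" "\<exists>x\<in>I. \<exists>y\<in>I. x < y"
    and deriv: "\<And>x. x \<in> I \<Longrightarrow> (h has_field_derivative h' x) (at x)"
  shows "h constant_on I \<longleftrightarrow> (\<forall>x\<in>I. h' x = 0)"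
proof
  assume "h constant_on I"
  then obtain c where c: "\<And>x. x \<in> I \<Longrightarrow> h x = c"
    by (auto simp: constant_on_def)
  show "\<forall>x\<in>I. h' x = 0"
  proof
    fix x assume x: "x \<in> I"
    have "((\<lambda>_. c) has_field_derivative h' x) (at x within I)"
      by (rule has_field_derivative_transform_within
            [OF has_field_derivative_at_within[OF deriv[OF x]] zero_less_one x])
         (simp add: c)
    moreover have "((\<lambda>_. c) has_field_derivative 0) (at x within I)"
      by simp
    moreover have "x islimpt I"
      using I x by (intro connected_imp_perfect is_interval_connected) auto
    then have "at x within I \<noteq> bot"
      by (simp add: trivial_limit_within)
    ultimately show "h' x = 0"
      by (rule has_field_derivative_unique)
  qed
next
  assume "\<forall>x\<in>I. h' x = 0"
  then have "\<exists>c. \<forall>x\<in>I. h x = c"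
    using I(1) deriv
    by (intro has_field_derivative_zero_constant)
       (auto simp: is_interval_convex intro: has_field_derivative_at_within dest: bspec)
  then show "h constant_on I"
    by (simp add: constant_on_def)
qed

lemma maximal_interval_of_constancy_transfer:
  assumes "maximal_interval_of_constancy a b r I"
    and "h constant_on I"
    and "\<And>J. interval_of_constancy a b h J \<Longrightarrow> I \<subseteq> J \<Longrightarrow> r constant_on J"
  shows "maximal_interval_of_constancy a b h I"
  using assms unfolding maximal_interval_of_constancy_def interval_of_constancy_def by blast

theorem proposition2:
  fixes a b :: ereal
    and f g r \<rho> \<rho>t :: "real \<Rightarrow> real"
    and I :: "real set"
  assumes "a < b"
    and "\<And>x. x \<in> einterval a b \<Longrightarrow> f differentiable (at x)"
    and "\<And>x. x \<in> einterval a b \<Longrightarrow> g differentiable (at x)"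
    and "\<And>x. x \<in> einterval a b \<Longrightarrow> g x \<noteq> 0"
    and "\<And>x. x \<in> einterval a b \<Longrightarrow> deriv g x \<noteq> 0"
    and "\<And>x. x \<in> einterval a b \<Longrightarrow> r x = f x / g x"
    and "\<And>x. x \<in> einterval a b \<Longrightarrow> \<rho> x = deriv f x / deriv g x"
    and "\<And>x. x \<in> einterval a b \<Longrightarrow> \<rho>t x = deriv r x * ((g x)\<^sup>2 / \<bar>deriv g x\<bar>)"
    and "mono_on (einterval a b) \<rho> \<or> antimono_on (einterval a b) \<rho>"
    and "maximal_interval_of_constancy a b r I"
  shows "maximal_interval_of_constancy a b \<rho> I \<and> maximal_interval_of_constancy a b \<rho>t I"
proof -
  note f_diff = assms(2) and g_diff = assms(3) and g_nz = assms(4) and g'_nz = assms(5)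
    and r_eq = assms(6) and \<rho>_eq = assms(7) and \<rho>t_eq = assms(8) and max_r = assms(10)
  have I: "I \<subseteq> einterval a b" "is_interval I" "\<exists>x\<in>I. \<exists>y\<in>I. x < y" "r constant_on I"
    using max_r by (auto simp: maximal_interval_of_constancy_def interval_of_constancy_def)
  then obtain x0 where x0: "x0 \<in> I" by blast
  define c where "c = r x0"
  have r_c: "r x = c" if "x \<in> I" for x
    using I(4) that x0 by (auto simp: constant_on_def c_def)

  have f': "(f has_field_derivative deriv f x) (at x)" if "x \<in> einterval a b" for x
    using f_diff[OF that] by (simp add: DERIV_deriv_iff_real_differentiable)
  have g': "(g has_field_derivative deriv g x) (at x)" if "x \<in> einterval a b" for x
    using g_diff[OF that] by (simp add: DERIV_deriv_iff_real_differentiable)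

  define F where "F = (\<lambda>x. f x - c * g x)"
  have F': "(F has_field_derivative deriv f x - c * deriv g x) (at x)"
    if "x \<in> einterval a b" for x
    unfolding F_def by (intro DERIV_diff DERIV_cmult f' g' that)
  have r_iff: "r x = c \<longleftrightarrow> F x = 0" if "x \<in> einterval a b" for x
    using r_eq[OF that] g_nz[OF that] by (simp add: F_def divide_eq_eq)
  have \<rho>_iff: "\<rho> x = c \<longleftrightarrow> deriv f x - c * deriv g x = 0" if "x \<in> einterval a b" for x
    using \<rho>_eq[OF that] g'_nz[OF that] by (simp add: divide_eq_eq)

  have F_constant_iff: "F constant_on J \<longleftrightarrow> (\<forall>x\<in>J. \<rho> x = c)"
    if "is_interval J" "J \<subseteq> einterval a b" "\<exists>x\<in>J. \<exists>y\<in>J. x < y" for J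
  proof -
    have "F constant_on J \<longleftrightarrow> (\<forall>x\<in>J. deriv f x - c * deriv g x = 0)"
      using that F' by (intro constant_on_iff_derivative_zero) auto
    also have "\<dots> \<longleftrightarrow> (\<forall>x\<in>J. \<rho> x = c)"
      using \<rho>_iff that(2) by (intro ball_cong) auto
    finally show ?thesis .
  qed

  have "F constant_on I"
    unfolding constant_on_def using r_c r_iff I(1) by blast
  then have \<rho>_I: "\<rho> x = c" if "x \<in> I" for x
    using F_constant_iff[OF I(2,1,3)] that by blast
  have max_\<rho>: "maximal_interval_of_constancy a b \<rho> I"
    using max_r
  proof (rule maximal_interval_of_constancy_transfer)
    show "\<rho> constant_on I"
      using \<rho>_I by (auto simp: constant_on_def)
    fix J assume J: "interval_of_constancy a b \<rho> J" "I \<subseteq> J"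
    then have J': "is_interval J" "J \<subseteq> einterval a b" "\<exists>x\<in>J. \<exists>y\<in>J. x < y" "\<rho> constant_on J"
      by (auto simp: interval_of_constancy_def)
    have "\<forall>x\<in>J. \<rho> x = c"
      using J'(4) \<rho>_I[OF x0] x0 J(2) unfolding constant_on_def by (metis subsetD)
    then have "F constant_on J"
      using F_constant_iff[OF J'(1-3)] by blast
    moreover have "F x0 = 0"
      using r_c[OF x0] r_iff x0 I(1) by blast
    ultimately have "\<forall>x\<in>J. F x = 0"
      using x0 J(2) unfolding constant_on_def by (metis subsetD)
    then show "r constant_on J"
      unfolding constant_on_def using r_iff J'(2) by blast
  qed

  have r': "(r has_field_derivative deriv r x) (at x)" if x: "x \<in> einterval a b" for x
  proof -
    have "(\<lambda>x. f x / g x) differentiable (at x)"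
      using f_diff g_diff g_nz x by (intro differentiable_divide) auto
    then have "((\<lambda>x. f x / g x) has_field_derivative deriv (\<lambda>x. f x / g x) x) (at x)"
      by (simp add: DERIV_deriv_iff_real_differentiable)
    then have "(r has_field_derivative deriv (\<lambda>x. f x / g x) x) (at x)"
      by (rule has_field_derivative_transform_within_open[OF _ open_einterval x])
         (simp add: r_eq)
    then show ?thesis
      by (metis DERIV_imp_deriv)
  qed
  have \<rho>t_iff: "\<rho>t x = 0 \<longleftrightarrow> deriv r x = 0" if "x \<in> einterval a b" for x
    using \<rho>t_eq[OF that] g_nz[OF that] g'_nz[OF that] by simp
  have r_constant_iff: "r constant_on J \<longleftrightarrow> (\<forall>x\<in>J. \<rho>t x = 0)"
    if "is_interval J" "J \<subseteq> einterval a b" "\<exists>x\<in>J. \<exists>y\<in>J. x < y" for J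
  proof -
    have "r constant_on J \<longleftrightarrow> (\<forall>x\<in>J. deriv r x = 0)"
      using that r' by (intro constant_on_iff_derivative_zero) auto
    also have "\<dots> \<longleftrightarrow> (\<forall>x\<in>J. \<rho>t x = 0)"
      using \<rho>t_iff that(2) by (intro ball_cong) auto
    finally show ?thesis .
  qed

  have \<rho>t_I: "\<rho>t x = 0" if "x \<in> I" for x
    using r_constant_iff[OF I(2,1,3)] I(4) that by blast
  have "maximal_interval_of_constancy a b \<rho>t I"
    using max_r
  proof (rule maximal_interval_of_constancy_transfer)
    show "\<rho>t constant_on I"
      using \<rho>t_I by (auto simp: constant_on_def)
    fix J assume J: "interval_of_constancy a b \<rho>t J" "I \<subseteq> J"
    then have J': "is_interval J" "J \<subseteq> einterval a b" "\<exists>x\<in>J. \<exists>y\<in>J. x < y" "\<rho>t constant_on J"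
      by (auto simp: interval_of_constancy_def)
    have "\<forall>x\<in>J. \<rho>t x = 0"
      using J'(4) \<rho>t_I[OF x0] x0 J(2) unfolding constant_on_def by (metis subsetD)
    then show "r constant_on J"
      using r_constant_iff[OF J'(1-3)] by blast
  qed
  with max_\<rho> show ?thesis ..
qed

end
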